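(* Let $\mathcal H$ be a real Hilbert space, let $r\geq 2$, let $M_1,\ldots,M_r\subseteq\mathcal H$ be closed linear subspaces and let $M:=\bigcap_{i=1}^r M_i$. Let $\mathbf C:=M_1\times\ldots\times M_r$ and $\mathbf D:=\{(x,\ldots,x)\mid x\in\mathcal H\}$, regarded as subspaces of the product Hilbert space $\mathcal H^r$ with scalar product $\langle \mathbf x,\mathbf y\rangle:=\frac 1r\sum_{i=1}^r\langle x_i,y_i\rangle$. Then, for every $k=1,2,\ldots$, $$\left\|\left(\frac 1 r \sum_{i=1}^r P_{M_i}\right)^k - P_M\right\| = \left\|\frac 1 r \sum_{i=1}^r P_{M_i} - P_M\right\|^k = \left(\frac{r-1}{r}\cos(M_1,\ldots,M_r)+\frac 1 r\right)^k = \cos(\mathbf C,\mathbf D)^{2k}$$ $$= \|P_{\mathbf D}P_{\mathbf C}P_{\mathbf D}-P_{\mathbf C\cap\mathbf D}\|^k = \|(P_{\mathbf D}P_{\mathbf C}P_{\mathbf D})^k-P_{\mathbf C\cap\mathbf D}\|.$$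
   Context: $P_C$ denotes the metric projection onto a nonempty closed convex set $C$ (the orthogonal projection when $C$ is a closed linear subspace); norms of operators are operator norms. In $\mathcal H^r$, $\mathbf x=(x_1,\ldots,x_r)$ and $\mathbf y=(y_1,\ldots,y_r)$ with $x_i,y_i\in\mathcal H$, and the norm, orthogonal complements and projections are taken with respect to the stated scalar product $\frac1r\sum_i\langle x_i,y_i\rangle$. The Friedrichs number of closed linear subspaces $M_1,\ldots,M_r$ with $M=\bigcap_i M_i$ is $$\cos(M_1,\ldots,M_r):=\sup\left\{\frac{1}{r-1}\frac{\sum_{i\neq j}\langle x_i,x_j\rangle}{\sum_{i=1}^r\|x_i\|^2}\ \middle|\ x_i\in M_i\cap M^\perp \text{ and } \sum_{i=1}^r\|x_i\|^2\neq 0\right\},$$ where the sum over $i\neq j$ runs over ordered pairs. For two closed linear subspaces $A,B$ of a real Hilbert space, the cosine of the Friedrichs angle is $$\cos(A,B):=\sup\{|\langle a,b\rangle| \mid a\in A\cap(A\cap B)^\perp,\ b\in B\cap (A\cap B)^\perp,\ \|a\|\leq 1,\ \|b\|\leq 1\}\in[0,1];$$ this is the definition used for $\cos(\mathbf C,\mathbf D)$ in $\mathcal H^r$.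
   Formalization: If all the subspaces M_1,…,M_r coincide, the set defining cos(M_1,…,M_r) is empty and its supremum is undefined; here the Friedrichs number is then taken to be −1/(r−1), the lower bound of all quotients, so every term of the chain is 0. *)

theory Defs
  imports "HOL-Analysis.Analysis"
begin

text \<open>
  Real Hilbert spaces are types of sort \<open>{real_inner, complete_space}\<close>. The finite index type
  \<open>'n\<close> plays the role of \<open>{1, \<dots>, r}\<close>, so that \<open>r = CARD('n)\<close>.
\<close>

subsection \<open>The product Hilbert space with the averaged scalar product\<close>

text \<open>
  The library type \<open>'a ^ 'n\<close> carries the unscaled scalar product; the type below is the same
  vector space with the scalar product (and hence the norm) scaled by \<open>1 / r\<close>.
\<close>

typedef ('a, 'n) hpow = "UNIV :: ('n \<Rightarrow> 'a) set"
  morphisms coord tuple ..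

lemma coord_tuple [simp]: "coord (tuple f) = f"
  by (simp add: tuple_inverse)

lemma tuple_coord [simp]: "tuple (coord x) = x"
  by (rule coord_inverse)

lemma hpow_eq_iff: "x = y \<longleftrightarrow> (\<forall>i. coord x i = coord y i)"
  by (metis coord_inject ext)

instantiation hpow :: (real_vector, type) real_vector
begin

definition zero_hpow :: "('a, 'b) hpow"
  where "0 = tuple (\<lambda>_. 0)"

definition plus_hpow :: "('a, 'b) hpow \<Rightarrow> ('a, 'b) hpow \<Rightarrow> ('a, 'b) hpow"
  where "x + y = tuple (\<lambda>i. coord x i + coord y i)"

definition minus_hpow :: "('a, 'b) hpow \<Rightarrow> ('a, 'b) hpow \<Rightarrow> ('a, 'b) hpow"
  where "x - y = tuple (\<lambda>i. coord x i - coord y i)"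

definition uminus_hpow :: "('a, 'b) hpow \<Rightarrow> ('a, 'b) hpow"
  where "- x = tuple (\<lambda>i. - coord x i)"

definition scaleR_hpow :: "real \<Rightarrow> ('a, 'b) hpow \<Rightarrow> ('a, 'b) hpow"
  where "scaleR c x = tuple (\<lambda>i. scaleR c (coord x i))"

instance
  by standard
    (simp_all add: hpow_eq_iff plus_hpow_def minus_hpow_def uminus_hpow_def zero_hpow_def
      scaleR_hpow_def algebra_simps)

end

instantiation hpow :: (real_inner, finite) real_normed_vector
begin

definition norm_hpow :: "('a, 'b) hpow \<Rightarrow> real"
  where "norm x = sqrt ((1 / real CARD('b)) * (\<Sum>i\<in>UNIV. inner (coord x i) (coord x i)))"

definition sgn_hpow
  where "sgn (x :: ('a, 'b) hpow) = scaleR (inverse (norm x)) x"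

definition dist_hpow
  where "dist (x :: ('a, 'b) hpow) y = norm (x - y)"

definition uniformity_hpow
  where "uniformity = (INF e\<in>{0<..}. principal {(x :: ('a, 'b) hpow, y). dist x y < e})"

definition open_hpow
  where "open (U :: ('a, 'b) hpow set) = (\<forall>x\<in>U. eventually (\<lambda>(x', y). x' = x \<longrightarrow> y \<in> U) uniformity)"

lemma norm_hpow_L2_set:
  "norm x = L2_set (\<lambda>i. norm (coord x i)) UNIV / sqrt (real CARD('b))"
  for x :: "('a, 'b) hpow"
  by (simp add: norm_hpow_def L2_set_def power2_norm_eq_inner real_sqrt_divide)

instance
proof
  fix x y :: "('a, 'b) hpow" and a :: real and U :: "('a, 'b) hpow set"
  show "sgn x = x /\<^sub>R norm x" by (rule sgn_hpow_def)
  show "dist x y = norm (x - y)" by (rule dist_hpow_def)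
  show "uniformity = (INF e\<in>{0<..}. principal {(x, y). dist (x :: ('a, 'b) hpow) y < e})"
    by (rule uniformity_hpow_def)
  show "open U = (\<forall>x\<in>U. eventually (\<lambda>(x', y). x' = x \<longrightarrow> y \<in> U) uniformity)"
    by (rule open_hpow_def)
  show "norm x = 0 \<longleftrightarrow> x = 0"
    by (simp add: norm_hpow_def sum_nonneg_eq_0_iff hpow_eq_iff zero_hpow_def)
  have "L2_set (\<lambda>i. norm (coord (x + y) i)) UNIV
      \<le> L2_set (\<lambda>i. norm (coord x i) + norm (coord y i)) UNIV"
    by (rule L2_set_mono) (auto simp: plus_hpow_def norm_triangle_ineq)
  also have "\<dots> \<le> L2_set (\<lambda>i. norm (coord x i)) UNIV + L2_set (\<lambda>i. norm (coord y i)) UNIV"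
    by (rule L2_set_triangle_ineq)
  finally show "norm (x + y) \<le> norm x + norm y"
    by (simp add: norm_hpow_L2_set divide_right_mono flip: add_divide_distrib)
  show "norm (a *\<^sub>R x) = \<bar>a\<bar> * norm x"
    by (simp add: norm_hpow_L2_set scaleR_hpow_def L2_set_right_distrib)
qed

end

instantiation hpow :: (real_inner, finite) real_inner
begin

definition inner_hpow :: "('a, 'b) hpow \<Rightarrow> ('a, 'b) hpow \<Rightarrow> real"
  where "inner x y = (1 / real CARD('b)) * (\<Sum>i\<in>UNIV. inner (coord x i) (coord y i))"

instance
proof
  fix x y z :: "('a, 'b) hpow" and a :: real
  show "inner x y = inner y x" by (simp add: inner_hpow_def inner_commute)
  show "inner (x + y) z = inner x z + inner y z"
    by (simp add: inner_hpow_def plus_hpow_def inner_add_left sum.distrib add_divide_distrib)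
  show "inner (a *\<^sub>R x) y = a * inner x y"
    by (simp add: inner_hpow_def scaleR_hpow_def sum_distrib_left)
  show "0 \<le> inner x x" by (simp add: inner_hpow_def sum_nonneg)
  show "inner x x = 0 \<longleftrightarrow> x = 0"
    by (simp add: inner_hpow_def sum_nonneg_eq_0_iff hpow_eq_iff zero_hpow_def)
  show "norm x = sqrt (inner x x)" by (simp add: norm_hpow_def inner_hpow_def)
qed

end

lemma norm_hpow_square:
  "(norm x)\<^sup>2 = (1 / real CARD('n)) * (\<Sum>i\<in>UNIV. (norm (coord x i))\<^sup>2)"
  for x :: "('a::real_inner, 'n::finite) hpow"
  by (simp add: power2_norm_eq_inner inner_hpow_def)

lemma coord_minus: "coord (x - y) i = coord x i - coord y i"
  by (simp add: minus_hpow_def)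

lemma norm_coord_le:
  "norm (coord x i) \<le> sqrt (real CARD('n)) * norm x"
  for x :: "('a::real_inner, 'n::finite) hpow"
proof -
  have "(norm (coord x i))\<^sup>2 \<le> (\<Sum>i\<in>UNIV. (norm (coord x i))\<^sup>2)"
    by (rule member_le_sum) auto
  also have "\<dots> = real CARD('n) * (norm x)\<^sup>2"
    by (simp add: norm_hpow_square)
  finally have "sqrt ((norm (coord x i))\<^sup>2) \<le> sqrt (real CARD('n) * (norm x)\<^sup>2)"
    by (rule real_sqrt_le_mono)
  then show ?thesis by (simp add: real_sqrt_mult)
qed

instance hpow :: ("{real_inner, complete_space}", finite) complete_space
proof
  fix X :: "nat \<Rightarrow> ('a, 'b) hpow"
  assume X: "Cauchy X"
  let ?s = "sqrt (real CARD('b))"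
  have s: "?s > 0" by simp
  have "Cauchy (\<lambda>n. coord (X n) i)" for i
  proof (rule metric_CauchyI)
    fix e :: real assume "e > 0"
    with s have "e / ?s > 0" by simp
    from metric_CauchyD[OF X this] obtain N
      where N: "\<forall>m\<ge>N. \<forall>n\<ge>N. dist (X m) (X n) < e / ?s" by blast
    have "dist (coord (X m) i) (coord (X n) i) < e" if "m \<ge> N" "n \<ge> N" for m n
    proof -
      have "dist (coord (X m) i) (coord (X n) i) \<le> ?s * dist (X m) (X n)"
        using norm_coord_le[of "X m - X n" i] by (simp add: dist_norm coord_minus)
      also have "\<dots> < ?s * (e / ?s)"
        using N that s by (intro mult_strict_left_mono) auto
      finally show ?thesis using s by simp
    qed
    then show "\<exists>N. \<forall>m\<ge>N. \<forall>n\<ge>N. dist (coord (X m) i) (coord (X n) i) < e" by blast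
  qed
  then have "\<exists>l. (\<lambda>n. coord (X n) i) \<longlonglongrightarrow> l" for i
    using Cauchy_convergent_iff convergent_def by blast
  then obtain l where l: "(\<lambda>n. coord (X n) i) \<longlonglongrightarrow> l i" for i
    by metis
  have "(\<lambda>n. (1 / real CARD('b)) * (\<Sum>i\<in>UNIV. (norm (coord (X n) i - l i))\<^sup>2))
      \<longlonglongrightarrow> (1 / real CARD('b)) * (\<Sum>i\<in>(UNIV :: 'b set). (norm (l i - l i))\<^sup>2)"
    by (intro tendsto_intros l)
  then have "(\<lambda>n. (norm (X n - tuple l))\<^sup>2) \<longlonglongrightarrow> 0"
    by (simp add: norm_hpow_square coord_minus)
  then have "(\<lambda>n. sqrt ((norm (X n - tuple l))\<^sup>2)) \<longlonglongrightarrow> sqrt 0"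
    by (rule tendsto_real_sqrt)
  then have "X \<longlonglongrightarrow> tuple l"
    by (simp add: tendsto_norm_zero_iff LIM_zero_iff)
  then show "convergent X" by (auto simp: convergent_def)
qed

subsection \<open>Projections and angles\<close>

text \<open>
  The library's \<open>closest_point\<close> is defined in the same way, but only for types of class
  \<open>heine_borel\<close>, which excludes infinite-dimensional Hilbert spaces.
\<close>

definition metric_proj :: "'a::real_inner set \<Rightarrow> 'a \<Rightarrow> 'a"
  where "metric_proj C x = (SOME p. p \<in> C \<and> (\<forall>y\<in>C. dist x p \<le> dist x y))"

definition cos_friedrichs :: "'a::real_inner set \<Rightarrow> 'a set \<Rightarrow> real"
  where "cos_friedrichs A B =
    Sup {\<bar>inner a b\<bar> | a b. a \<in> A \<inter> (A \<inter> B)\<^sup>\<bottom> \<and> b \<in> B \<inter> (A \<inter> B)\<^sup>\<bottom> \<and> norm a \<le> 1 \<and> norm b \<le> 1}"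

definition friedrichs_quotients :: "('n::finite \<Rightarrow> 'a::real_inner set) \<Rightarrow> real set"
  where "friedrichs_quotients M =
    {1 / (real CARD('n) - 1) *
       ((\<Sum>(i, j)\<in>{(i, j). i \<noteq> j}. inner (x i) (x j)) / (\<Sum>i\<in>UNIV. (norm (x i))\<^sup>2)) | x.
     (\<forall>i. x i \<in> M i \<inter> (\<Inter>j. M j)\<^sup>\<bottom>) \<and> (\<Sum>i\<in>UNIV. (norm (x i))\<^sup>2) \<noteq> 0}"

text \<open>
  The set of quotients is empty exactly when all the subspaces coincide. Every quotient is at
  least \<open>- 1 / (r - 1)\<close> for any choice of vectors (lemma \<open>friedrichs_quotients_ge\<close>), and the
  supremum of the empty set is taken to be this lower bound.
\<close>

definition friedrichs_number :: "('n::finite \<Rightarrow> 'a::real_inner set) \<Rightarrow> real"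
  where "friedrichs_number M =
    (if friedrichs_quotients M = {} then - 1 / (real CARD('n) - 1)
     else Sup (friedrichs_quotients M))"

lemma friedrichs_quotient_ge:
  fixes x :: "'n::finite \<Rightarrow> 'a::real_inner"
  assumes r: "CARD('n) \<ge> 2" and nz: "(\<Sum>i\<in>UNIV. (norm (x i))\<^sup>2) \<noteq> 0"
  shows "- 1 / (real CARD('n) - 1) \<le> 1 / (real CARD('n) - 1) *
    ((\<Sum>(i, j)\<in>{(i, j). i \<noteq> j}. inner (x i) (x j)) / (\<Sum>i\<in>UNIV. (norm (x i))\<^sup>2))"
proof -
  let ?S = "\<Sum>i\<in>UNIV. (norm (x i))\<^sup>2"
  let ?O = "\<Sum>(i, j)\<in>{(i, j). i \<noteq> j}. inner (x i) (x j)"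
  have S: "?S > 0"
    using nz by (metis order_le_less sum_nonneg zero_le_power2)
  have "0 \<le> inner (\<Sum>i\<in>UNIV. x i) (\<Sum>i\<in>UNIV. x i)"
    by simp
  also have "\<dots> = (\<Sum>(i, j)\<in>UNIV. inner (x i) (x j))"
    by (simp add: inner_sum_left inner_sum_right sum.cartesian_product inner_commute)
  also have "(UNIV :: ('n \<times> 'n) set) = {(i, j). i \<noteq> j} \<union> (\<lambda>i. (i, i)) ` UNIV"
    by auto
  also have "(\<Sum>(i, j)\<in>\<dots>. inner (x i) (x j)) =
      ?O + (\<Sum>(i, j)\<in>(\<lambda>i. (i, i)) ` UNIV. inner (x i) (x j))"
    by (rule sum.union_disjoint) auto
  also have "(\<Sum>(i, j)\<in>(\<lambda>i. (i, i)) ` UNIV. inner (x i) (x j)) = ?S"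
    by (subst sum.reindex) (auto simp: inj_on_def power2_norm_eq_inner)
  finally have "- 1 \<le> ?O / ?S"
    using S by (simp add: field_simps)
  then have "1 / (real CARD('n) - 1) * (- 1) \<le> 1 / (real CARD('n) - 1) * (?O / ?S)"
    using r by (intro mult_left_mono) auto
  then show ?thesis by simp
qed

lemma friedrichs_quotients_ge:
  fixes M :: "'n::finite \<Rightarrow> 'a::real_inner set"
  assumes "CARD('n) \<ge> 2" and "q \<in> friedrichs_quotients M"
  shows "- 1 / (real CARD('n) - 1) \<le> q"
  using assms(2) friedrichs_quotient_ge[OF assms(1)] unfolding friedrichs_quotients_def by blast

subsection \<open>The operators and subspaces of the simultaneous projection method\<close>

definition mean_proj :: "('n::finite \<Rightarrow> 'a::real_inner set) \<Rightarrow> 'a \<Rightarrow> 'a"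
  where "mean_proj M x = (1 / real CARD('n)) *\<^sub>R (\<Sum>i\<in>UNIV. metric_proj (M i) x)"

definition product_subspace :: "('n \<Rightarrow> 'a set) \<Rightarrow> ('a, 'n) hpow set"
  where "product_subspace M = {x. \<forall>i. coord x i \<in> M i}"

definition diagonal_subspace :: "('a, 'n) hpow set"
  where "diagonal_subspace = {tuple (\<lambda>_. x) | x. True}"

end

theory Submission
  imports Defs
begin

text \<open>
  Let \<open>T\<close> be the mean of the projections onto the \<open>M\<^sub>i\<close>, let \<open>P\<close> be the projection onto \<open>M\<close>, and let
  \<open>J u = (u, \<dots>, u)\<close> be the diagonal embedding of \<open>H\<close> into \<open>H\<^sup>r\<close>. For the averaged scalar product
  \<open>J\<close> is an isometry and its adjoint \<open>J*\<close> is the average of the coordinates. Every number in the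
  theorem is a power of one operator norm, obtained as follows.

  Put \<open>N\<^sub>i = M\<^sub>i \<inter> M\<^sup>\<bottom>\<close>. The projection onto \<open>N\<^sub>i\<close> is that onto \<open>M\<^sub>i\<close> minus \<open>P\<close>
  (\<open>metric_proj_relative\<close>), so \<open>T - P\<close> is the mean of the projections onto the \<open>N\<^sub>i\<close>. The projection
  onto \<open>N\<^sub>1 \<times> \<dots> \<times> N\<^sub>r\<close> acts coordinatewise; hence, if \<open>V\<close> denotes this projection
  composed with \<open>J\<close> (\<open>lifted_proj\<close>), then \<open>T - P = V* V\<close>. Let \<open>s\<close> be the norm of \<open>V\<close>.

  \<^item> The norm of \<open>T - P = V* V\<close> is \<open>s\<^sup>2\<close> (\<open>onorm_mean_proj\<close>).

  \<^item> The sum over \<open>i \<noteq> j\<close> in a Friedrichs quotient is \<open>\<parallel>\<Sum>x\<^sub>i\<parallel>\<^sup>2 - \<Sum>\<parallel>x\<^sub>i\<parallel>\<^sup>2\<close>, so the affine map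
  \<open>q \<mapsto> (r - 1) / r * q + 1 / r\<close> turns the quotient of \<open>x\<close> into \<open>(\<parallel>J* x\<parallel> / \<parallel>x\<parallel>)\<^sup>2\<close>. Here \<open>x\<close>
  runs through the product of the \<open>N\<^sub>i\<close>, on which \<open>J*\<close> is \<open>V*\<close>; the supremum is therefore
  \<open>s\<^sup>2\<close> (\<open>friedrichs_number_eq\<close>).

  \<^item> The elements of \<open>D\<close> orthogonal to \<open>C \<inter> D = J M\<close> are the \<open>J u\<close> with \<open>u \<in> M\<^sup>\<bottom>\<close>, and for
  \<open>a \<in> C\<close> the product \<open>\<langle>a, J u\<rangle>\<close> equals \<open>\<langle>a, V u\<rangle>\<close>; maximizing over \<open>a\<close> and \<open>u\<close> gives \<open>s\<close>
  (\<open>cos_product_diagonal\<close>).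

  \<^item> The operators on the product space are conjugates of those on \<open>H\<close>: the product
  \<open>P\<^sub>D P\<^sub>C P\<^sub>D\<close> is \<open>J T J*\<close>, the projection onto \<open>C \<inter> D\<close> is \<open>J P J*\<close>, and \<open>A \<mapsto> J A J*\<close>
  preserves products and norms (\<open>onorm_diag_conjugate\<close>).

  Finally, since \<open>T P = P T = P\<close>, the powers satisfy \<open>T\<^sup>k - P = (T - P)\<^sup>k\<close> for \<open>k \<ge> 1\<close>, and the
  self-adjoint operator \<open>T - P\<close> satisfies \<open>\<parallel>(T - P)\<^sup>k\<parallel> = \<parallel>T - P\<parallel>\<^sup>k\<close>
  (\<open>onorm_funpow_selfadjoint\<close>).
\<close>

section \<open>Orthogonal projections\<close>

text \<open>
  What completeness of \<open>H\<close> provides is the existence of orthogonal projections. Taking that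
  existence as a property of the subspace lets it be transferred to relative complements and
  products by exhibiting the projection.
\<close>

definition complemented :: "'a::real_inner set \<Rightarrow> bool"
  where "complemented S \<longleftrightarrow> subspace S \<and> (\<forall>x. \<exists>p\<in>S. x - p \<in> S\<^sup>\<bottom>)"

lemma mem_orthogonal_comp_iff: "x \<in> S\<^sup>\<bottom> \<longleftrightarrow> (\<forall>y\<in>S. inner x y = 0)"
  by (auto simp: orthogonal_comp_def orthogonal_def inner_commute)

lemma complemented_imp_subspace: "complemented S \<Longrightarrow> subspace S"
  by (simp add: complemented_def)

text \<open>
  By Pythagoras, a point of \<open>S\<close> whose difference from \<open>x\<close> is orthogonal to \<open>S\<close> is the unique
  nearest point, so the choice in the definition of \<^const>\<open>metric_proj\<close> has to return it.
\<close>

lemma metric_proj_eqI: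
  assumes "subspace S" "p \<in> S" "x - p \<in> S\<^sup>\<bottom>"
  shows "metric_proj S x = p"
proof -
  have pyth: "(dist x y)\<^sup>2 = (dist x p)\<^sup>2 + (norm (p - y))\<^sup>2" if "y \<in> S" for y
  proof -
    have "inner (x - p) (p - y) = 0"
      using assms that by (auto simp: mem_orthogonal_comp_iff subspace_diff)
    then show ?thesis
      using norm_add_Pythagorean[of "x - p" "p - y"] by (simp add: dist_norm orthogonal_def)
  qed
  show ?thesis
    unfolding metric_proj_def
  proof (rule some_equality)
    have "dist x p \<le> dist x y" if "y \<in> S" for y
      by (rule power2_le_imp_le) (simp_all add: pyth[OF that])
    then show "p \<in> S \<and> (\<forall>y\<in>S. dist x p \<le> dist x y)"
      using assms(2) by blast
  next
    fix q assume q: "q \<in> S \<and> (\<forall>y\<in>S. dist x q \<le> dist x y)"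
    then have "(dist x q)\<^sup>2 \<le> (dist x p)\<^sup>2"
      using assms(2) by (intro power_mono) auto
    with pyth[of q] q have "(norm (p - q))\<^sup>2 \<le> 0" by simp
    then show "q = p" by simp
  qed
qed

lemma complementedI:
  assumes "subspace S" "\<And>x. f x \<in> S" "\<And>x. x - f x \<in> S\<^sup>\<bottom>"
  shows "complemented S" "metric_proj S = f"
  using assms by (auto simp: complemented_def intro!: metric_proj_eqI)

lemma
  assumes "complemented S"
  shows metric_proj_in: "metric_proj S x \<in> S"
    and metric_proj_orthogonal: "x - metric_proj S x \<in> S\<^sup>\<bottom>"
proof -
  obtain p where p: "p \<in> S" "x - p \<in> S\<^sup>\<bottom>"
    using assms by (auto simp: complemented_def)
  moreover have "metric_proj S x = p"
    using assms p by (intro metric_proj_eqI) (auto simp: complemented_def)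
  ultimately show "metric_proj S x \<in> S" "x - metric_proj S x \<in> S\<^sup>\<bottom>" by simp_all
qed

lemma inner_metric_proj_member:
  assumes "complemented S" "y \<in> S"
  shows "inner (metric_proj S x) y = inner x y"
  using metric_proj_orthogonal[OF assms(1), of x] assms(2)
  by (simp add: mem_orthogonal_comp_iff inner_diff_left)

lemma metric_proj_member: "complemented S \<Longrightarrow> x \<in> S \<Longrightarrow> metric_proj S x = x"
  by (rule metric_proj_eqI) (auto simp: complemented_def mem_orthogonal_comp_iff)

lemma metric_proj_orthogonal_comp:
  "complemented S \<Longrightarrow> x \<in> S\<^sup>\<bottom> \<Longrightarrow> metric_proj S x = 0"
  by (rule metric_proj_eqI) (auto simp: complemented_def subspace_0)

lemma norm_metric_proj_le:
  assumes "complemented S"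
  shows "norm (metric_proj S x) \<le> norm x"
proof -
  let ?p = "metric_proj S x"
  have "norm ?p * norm ?p = inner x ?p"
    using inner_metric_proj_member[OF assms metric_proj_in[OF assms], of x x]
    by (metis power2_eq_square power2_norm_eq_inner)
  also have "\<dots> \<le> norm x * norm ?p" by (rule norm_cauchy_schwarz)
  finally show ?thesis
    by (metis mult_le_cancel_right norm_ge_zero order_le_less norm_le_zero_iff order_trans norm_zero)
qed

lemma bounded_linear_metric_proj:
  assumes "complemented S"
  shows "bounded_linear (metric_proj S)"
proof (rule bounded_linear_intro[where K = 1])
  note S = complemented_imp_subspace[OF assms]
  note perp = subspace_orthogonal_comp[of S]
  fix x y :: 'a and c :: real
  have "x + y - (metric_proj S x + metric_proj S y)
      = (x - metric_proj S x) + (y - metric_proj S y)" by simp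
  also have "\<dots> \<in> S\<^sup>\<bottom>"
    using metric_proj_orthogonal[OF assms] perp by (blast intro: subspace_add)
  finally show "metric_proj S (x + y) = metric_proj S x + metric_proj S y"
    using S metric_proj_in[OF assms] by (intro metric_proj_eqI) (auto intro: subspace_add)
  have "c *\<^sub>R x - c *\<^sub>R metric_proj S x \<in> S\<^sup>\<bottom>"
    using metric_proj_orthogonal[OF assms] perp
    by (metis scaleR_diff_right subspace_scale)
  then show "metric_proj S (c *\<^sub>R x) = c *\<^sub>R metric_proj S x"
    using S metric_proj_in[OF assms] by (intro metric_proj_eqI) (auto intro: subspace_scale)
  show "norm (metric_proj S x) \<le> norm x * 1"
    using norm_metric_proj_le[OF assms] by simp
qed

text \<open>
  The projection theorem: the parallelogram law makes a minimizing sequence Cauchy, and the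
  obtuse-angle inequality at its limit \<open>p\<close>, applied to \<open>p + z\<close> and \<open>p - z\<close>, gives orthogonality.
\<close>

lemma closed_subspace_complemented:
  fixes S :: "'a::{real_inner, complete_space} set"
  assumes S: "subspace S" and "closed S"
  shows "complemented S"
  unfolding complemented_def
proof (intro conjI allI S)
  fix x
  define d where "d = (INF y\<in>S. (norm (x - y))\<^sup>2)"
  have bdd: "bdd_below ((\<lambda>y. (norm (x - y))\<^sup>2) ` S)"
    by (auto intro!: bdd_belowI[of _ 0])
  have ne: "S \<noteq> {}" using S subspace_0 by blast
  have d_le: "d \<le> (norm (x - y))\<^sup>2" if "y \<in> S" for y
    unfolding d_def using bdd that by (rule cINF_lower)
  \<comment> \<open>With squared distances the error terms add up directly in the parallelogram law.\<close>
  have "\<exists>y\<in>S. (norm (x - y))\<^sup>2 < d + 1 / real (Suc n)" for n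
    using cINF_less_iff[OF ne bdd, of "d + 1 / real (Suc n)"] by (simp flip: d_def)
  then obtain y where y: "y n \<in> S" "(norm (x - y n))\<^sup>2 < d + 1 / real (Suc n)" for n
    by metis
  have close: "(norm (y m - y n))\<^sup>2 \<le> 2 / real (Suc m) + 2 / real (Suc n)" for m n
  proof -
    have "(1/2) *\<^sub>R (y m + y n) \<in> S"
      using y S by (intro subspace_scale subspace_add) auto
    then have "d \<le> (norm (x - (1/2) *\<^sub>R (y m + y n)))\<^sup>2" by (rule d_le)
    moreover have "(norm (y m - y n))\<^sup>2 + 4 * (norm (x - (1/2) *\<^sub>R (y m + y n)))\<^sup>2
        = 2 * (norm (x - y m))\<^sup>2 + 2 * (norm (x - y n))\<^sup>2"
      by (simp add: power2_norm_eq_inner algebra_simps inner_commute)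
    ultimately show ?thesis using y(2)[of m] y(2)[of n] by simp
  qed
  have "Cauchy y"
  proof (rule metric_CauchyI)
    fix e :: real assume e: "e > 0"
    obtain N where N: "4 / e\<^sup>2 < real N" using reals_Archimedean2 by blast
    have "dist (y m) (y n) < e" if "m \<ge> N" "n \<ge> N" for m n
    proof -
      have N0: "real N > 0" using N e by (smt (verit) divide_pos_pos zero_less_power)
      have "(dist (y m) (y n))\<^sup>2 \<le> 2 / real (Suc m) + 2 / real (Suc n)"
        using close by (simp add: dist_norm)
      also have "\<dots> \<le> 2 / real N + 2 / real N"
        using that N0 by (intro add_mono divide_left_mono) auto
      also have "\<dots> < e\<^sup>2" using N N0 e by (simp add: field_simps)
      finally show ?thesis using e by (simp add: power2_less_imp_less)
    qed
    then show "\<exists>N. \<forall>m\<ge>N. \<forall>n\<ge>N. dist (y m) (y n) < e" by blast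
  qed
  then obtain p where p: "y \<longlonglongrightarrow> p"
    using Cauchy_convergent_iff convergent_def by blast
  have pS: "p \<in> S"
    using \<open>closed S\<close> y(1) p by (auto simp: closed_sequential_limits)
  have "(\<lambda>n. (norm (x - y n))\<^sup>2) \<longlonglongrightarrow> (norm (x - p))\<^sup>2"
    by (intro tendsto_intros p)
  moreover have "(\<lambda>n. d + 1 / real (Suc n)) \<longlonglongrightarrow> d + 0"
    by (intro tendsto_intros LIMSEQ_Suc[OF lim_1_over_n])
  ultimately have "(norm (x - p))\<^sup>2 \<le> d + 0"
    by (rule LIMSEQ_le) (use y(2) less_imp_le in blast)
  then have "(norm (x - p))\<^sup>2 \<le> (norm (x - z))\<^sup>2" if "z \<in> S" for z
    using d_le[OF that] by linarith
  then have "\<forall>z\<in>S. dist x p \<le> dist x z"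
    unfolding dist_norm by (metis norm_ge_zero power2_le_imp_le)
  then have var: "inner (x - p) (z - p) \<le> 0" if "z \<in> S" for z
    using any_closest_point_dot[OF subspace_imp_convex[OF S] \<open>closed S\<close> pS that] by blast
  have "inner (x - p) z = 0" if "z \<in> S" for z
    using var[of "p + z"] var[of "p - z"] pS that S by (simp add: subspace_add subspace_diff)
  then show "\<exists>p\<in>S. x - p \<in> S\<^sup>\<bottom>"
    using pS by (auto simp: mem_orthogonal_comp_iff)
qed

text \<open>
  \<open>A\<close> is the orthogonal sum of \<open>B\<close> and \<open>A \<inter> B\<^sup>\<bottom>\<close>, so the projections onto the two summands add up
  to the projection onto \<open>A\<close>.
\<close>

lemma
  assumes A: "complemented A" and B: "complemented B" and "B \<subseteq> A"
  shows complemented_relative: "complemented (A \<inter> B\<^sup>\<bottom>)"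
    and metric_proj_relative: "metric_proj (A \<inter> B\<^sup>\<bottom>) x = metric_proj A x - metric_proj B x"
proof -
  note AB = complemented_imp_subspace[OF A] complemented_imp_subspace[OF B]
  have sub: "subspace (A \<inter> B\<^sup>\<bottom>)"
    using AB by (intro subspace_inter subspace_orthogonal_comp)
  have inA: "metric_proj A x - metric_proj B x \<in> A" for x
    using AB metric_proj_in[OF A] metric_proj_in[OF B] \<open>B \<subseteq> A\<close> by (blast intro: subspace_diff)
  moreover have "metric_proj A x - metric_proj B x \<in> B\<^sup>\<bottom>" for x
    using inner_metric_proj_member[OF A] inner_metric_proj_member[OF B] \<open>B \<subseteq> A\<close>
    by (auto simp: mem_orthogonal_comp_iff inner_diff_left)
  ultimately have in': "metric_proj A x - metric_proj B x \<in> A \<inter> B\<^sup>\<bottom>" for x by blast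
  have orth: "x - (metric_proj A x - metric_proj B x) \<in> (A \<inter> B\<^sup>\<bottom>)\<^sup>\<bottom>" for x
    using inner_metric_proj_member[OF A] metric_proj_in[OF B]
    by (auto simp: mem_orthogonal_comp_iff inner_diff_left inner_commute[of "metric_proj B x"])
  show "complemented (A \<inter> B\<^sup>\<bottom>)"
    "metric_proj (A \<inter> B\<^sup>\<bottom>) x = metric_proj A x - metric_proj B x"
    using complementedI[OF sub in' orth] by simp_all
qed

lemma metric_proj_subset:
  assumes A: "complemented A" and B: "complemented B" and "B \<subseteq> A"
  shows "metric_proj B (metric_proj A x) = metric_proj B x"
proof -
  have "metric_proj B (x - metric_proj A x) = 0"
    using metric_proj_orthogonal[OF A] \<open>B \<subseteq> A\<close> orthogonal_comp_anti_mono
    by (intro metric_proj_orthogonal_comp[OF B]) blast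
  then show ?thesis
    using bounded_linear_metric_proj[OF B] by (simp add: linear_simps(2))
qed

section \<open>Norms of operators on an inner product space\<close>

text \<open>
  From \<open>T P = P T = P\<^sup>2 = P\<close> all mixed terms of \<open>(T - P)\<^sup>k\<close> collapse to \<open>P\<close>. For \<open>k = 0\<close> the two
  sides are \<open>x - P x\<close> and \<open>x\<close>, hence the lower bound on \<open>k\<close>.
\<close>

lemma funpow_minus_projection:
  assumes T: "linear T" and P: "linear P"
    and TP: "\<And>x. T (P x) = P x" and PT: "\<And>x. P (T x) = P x" and PP: "\<And>x. P (P x) = P x"
    and k: "k \<ge> 1"
  shows "(T ^^ k) x - P x = ((\<lambda>x. T x - P x) ^^ k) x"
  using k
proof (induction k rule: dec_induct)
  case base
  show ?case by simp
next
  case (step k)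
  have "P ((T ^^ n) x) = P x" for n by (induction n) (simp_all add: PT)
  then have "(T ^^ Suc k) x - P x = T ((T ^^ k) x - P x) - P ((T ^^ k) x - P x)"
    by (simp add: linear_diff[OF T] linear_diff[OF P] TP PP)
  then show ?case by (simp add: step.IH)
qed

lemma bounded_linear_funpow:
  fixes S :: "'a::real_normed_vector \<Rightarrow> 'a"
  assumes "bounded_linear S"
  shows "bounded_linear (S ^^ n)"
proof (induction n)
  case (Suc n)
  then show ?case using bounded_linear_compose[OF assms Suc] by (simp add: o_def)
qed (simp add: id_def)

text \<open>
  Self-adjointness serves to prove \<open>\<parallel>S\<parallel>\<^sup>k \<le> \<parallel>S\<^sup>k\<parallel>\<close>. By Cauchy-Schwarz applied to
  \<open>\<parallel>S\<^bsup>n+1\<^esup> x\<parallel>\<^sup>2 = \<langle>S\<^sup>n x, S\<^bsup>n+2\<^esup> x\<rangle>\<close>, the sequence \<open>\<parallel>S\<^sup>n x\<parallel>\<close> is log-convex: its successive ratios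
  increase, so each is at least the first one, \<open>\<parallel>S x\<parallel> / \<parallel>x\<parallel>\<close>. Multiplying them gives
  \<open>\<parallel>S x\<parallel>\<^sup>k \<le> \<parallel>x\<parallel>\<^bsup>k-1\<^esup> \<parallel>S\<^sup>k x\<parallel>\<close>, and the norm of \<open>S\<close> is bounded by the \<open>k\<close>-th root of the norm of
  \<open>S\<^sup>k\<close>.
\<close>

lemma onorm_funpow_selfadjoint:
  fixes S :: "'a::real_inner \<Rightarrow> 'a"
  assumes S: "bounded_linear S" and adj: "\<And>x y. inner (S x) y = inner x (S y)" and k: "k \<ge> 1"
  shows "onorm (S ^^ k) = onorm S ^ k"
proof (rule antisym)
  note lin = bounded_linear_funpow[OF S]
  have S0: "S 0 = 0" using S by (simp add: linear_simps)
  have pos: "onorm S \<ge> 0" using S by (rule onorm_pos_le)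
  have "norm ((S ^^ n) x) \<le> onorm S ^ n * norm x" for n x
  proof (induction n)
    case (Suc n)
    have "norm (S ((S ^^ n) x)) \<le> onorm S * norm ((S ^^ n) x)" by (rule onorm[OF S])
    also have "\<dots> \<le> onorm S * (onorm S ^ n * norm x)" by (intro mult_left_mono Suc pos)
    finally show ?case by simp
  qed simp
  then show "onorm (S ^^ k) \<le> onorm S ^ k"
    by (intro onorm_bound zero_le_power pos)
  have convex: "(norm ((S ^^ Suc n) x))\<^sup>2 \<le> norm ((S ^^ n) x) * norm ((S ^^ Suc (Suc n)) x)" for n x
  proof -
    have "(norm ((S ^^ Suc n) x))\<^sup>2 = inner ((S ^^ n) x) ((S ^^ Suc (Suc n)) x)"
      by (simp add: power2_norm_eq_inner adj)
    also have "\<dots> \<le> norm ((S ^^ n) x) * norm ((S ^^ Suc (Suc n)) x)"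
      by (rule norm_cauchy_schwarz)
    finally show ?thesis .
  qed
  have ratio: "norm (S x) * norm ((S ^^ n) x) \<le> norm x * norm ((S ^^ Suc n) x)" for n x
  proof (induction n)
    case (Suc n)
    let ?a = "\<lambda>n. norm ((S ^^ n) x)"
    show ?case
    proof (cases "?a n = 0")
      case True
      then show ?thesis by (simp add: S0)
    next
      case False
      have "?a n * (norm (S x) * ?a (Suc n)) = (norm (S x) * ?a n) * ?a (Suc n)" by simp
      also have "\<dots> \<le> (norm x * ?a (Suc n)) * ?a (Suc n)"
        by (rule mult_right_mono[OF Suc]) simp
      also have "\<dots> = norm x * (?a (Suc n))\<^sup>2" by (simp add: power2_eq_square)
      also have "\<dots> \<le> norm x * (?a n * ?a (Suc (Suc n)))"
        by (intro mult_left_mono convex) simp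
      also have "\<dots> = ?a n * (norm x * ?a (Suc (Suc n)))" by simp
      finally show ?thesis using False
        by (simp only: mult_le_cancel_left) (use False norm_ge_zero[of "(S ^^ n) x"] in linarith)
    qed
  qed (simp add: mult.commute)
  have power: "norm (S x) ^ Suc n \<le> norm x ^ n * norm ((S ^^ Suc n) x)" for n x
  proof (induction n)
    case (Suc n)
    have "norm (S x) ^ Suc (Suc n) \<le> norm (S x) * (norm x ^ n * norm ((S ^^ Suc n) x))"
      using mult_left_mono[OF Suc, of "norm (S x)"] by simp
    also have "\<dots> = norm x ^ n * (norm (S x) * norm ((S ^^ Suc n) x))" by simp
    also have "\<dots> \<le> norm x ^ n * (norm x * norm ((S ^^ Suc (Suc n)) x))"
      by (intro mult_left_mono ratio) simp
    finally show ?case by (simp add: mult_ac)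
  qed simp
  define c where "c = root k (onorm (S ^^ k))"
  have onk: "onorm (S ^^ k) \<ge> 0" by (rule onorm_pos_le[OF lin])
  then have c: "c \<ge> 0" "c ^ k = onorm (S ^^ k)" using k by (auto simp: c_def)
  obtain n where n: "k = Suc n" using k by (cases k) auto
  have "norm (S x) \<le> c * norm x" for x
  proof (rule power_le_imp_le_base[of _ n])
    have "norm (S x) ^ Suc n \<le> norm x ^ n * norm ((S ^^ k) x)" using power n by simp
    also have "\<dots> \<le> norm x ^ n * (onorm (S ^^ k) * norm x)"
      by (intro mult_left_mono onorm[OF lin]) simp
    also have "\<dots> = (c * norm x) ^ Suc n" using c(2) n by (simp add: power_mult_distrib flip: c(2))
    finally show "norm (S x) ^ Suc n \<le> (c * norm x) ^ Suc n" .
  qed (use c in simp)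
  then have "onorm S \<le> c" by (rule onorm_bound[OF c(1)])
  then show "onorm S ^ k \<le> onorm (S ^^ k)"
    using power_mono[of "onorm S" c k] pos c(2) by simp
qed

text \<open>
  The identity \<open>\<parallel>V* V\<parallel> = \<parallel>V\<parallel>\<^sup>2\<close>. The hypothesis \<open>gram\<close> says \<open>A = V* V\<close> without mentioning an adjoint
  of \<open>V\<close>, whose existence would need completeness.
\<close>

lemma onorm_adjoint_compose:
  fixes V :: "'a::real_inner \<Rightarrow> 'b::real_inner"
  assumes V: "bounded_linear V" and A: "bounded_linear A"
    and gram: "\<And>x y. inner (A x) y = inner (V x) (V y)"
  shows "onorm A = (onorm V)\<^sup>2"
proof (rule antisym)
  show "onorm A \<le> (onorm V)\<^sup>2"
  proof (rule onorm_bound)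
    fix x
    have "norm (A x) * norm (A x) = inner (V x) (V (A x))"
      by (simp add: power2_norm_eq_inner gram flip: power2_eq_square)
    also have "\<dots> \<le> norm (V x) * norm (V (A x))" by (rule norm_cauchy_schwarz)
    also have "\<dots> \<le> (onorm V * norm x) * (onorm V * norm (A x))"
      by (intro mult_mono onorm[OF V] mult_nonneg_nonneg onorm_pos_le[OF V]) auto
    finally have "norm (A x) * norm (A x) \<le> ((onorm V)\<^sup>2 * norm x) * norm (A x)"
      by (simp add: power2_eq_square mult_ac)
    then show "norm (A x) \<le> (onorm V)\<^sup>2 * norm x"
      by (cases "A x = 0") auto
  qed simp
  have "onorm V \<le> sqrt (onorm A)"
  proof (rule onorm_bound)
    fix x
    have "(norm (V x))\<^sup>2 = inner (A x) x" by (simp add: power2_norm_eq_inner gram)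
    also have "\<dots> \<le> norm (A x) * norm x" by (rule norm_cauchy_schwarz)
    also have "\<dots> \<le> (onorm A * norm x) * norm x" by (intro mult_right_mono onorm[OF A]) simp
    finally have "sqrt ((norm (V x))\<^sup>2) \<le> sqrt (onorm A * (norm x)\<^sup>2)"
      by (intro real_sqrt_le_mono) (simp add: power2_eq_square mult_ac)
    then show "norm (V x) \<le> sqrt (onorm A) * norm x" by (simp add: real_sqrt_mult)
  qed (simp add: onorm_pos_le[OF A])
  then have "(onorm V)\<^sup>2 \<le> (sqrt (onorm A))\<^sup>2" by (intro power_mono onorm_pos_le[OF V])
  then show "(onorm V)\<^sup>2 \<le> onorm A" by (simp add: onorm_pos_le[OF A])
qed

section \<open>The diagonal embedding and the average\<close>

definition diag :: "'a \<Rightarrow> ('a, 'n) hpow"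
  where "diag u = tuple (\<lambda>_. u)"

definition avg :: "('a::real_vector, 'n::finite) hpow \<Rightarrow> 'a"
  where "avg x = (1 / real CARD('n)) *\<^sub>R (\<Sum>i\<in>UNIV. coord x i)"

lemma coord_simps [simp]:
  "coord (x + y) i = coord x i + coord y i" "coord (x - y) i = coord x i - coord y i"
  "coord (c *\<^sub>R x) i = c *\<^sub>R coord x i" "coord 0 i = 0" "coord (diag u) i = u"
  by (simp_all add: plus_hpow_def minus_hpow_def scaleR_hpow_def zero_hpow_def diag_def)

lemma avg_diag [simp]: "avg (diag u) = u"
  by (simp add: avg_def sum_constant_scaleR)

text \<open>
  With the factor \<open>1 / r\<close> in the scalar product, \<^const>\<open>avg\<close> is the adjoint of \<^const>\<open>diag\<close>.
\<close>

lemma inner_diag: "inner (diag u) x = inner u (avg x)"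
  by (simp add: inner_hpow_def avg_def inner_sum_right)

lemma inner_diag_right: "inner x (diag u) = inner (avg x) u"
  by (simp add: inner_commute[of x] inner_diag inner_commute[of u])

lemma norm_diag [simp]: "norm (diag u :: ('a::real_inner, 'n::finite) hpow) = norm u"
  by (simp add: norm_eq_sqrt_inner inner_diag)

lemma norm_avg_le: "norm (avg x) \<le> norm x"
proof -
  have "norm (avg x) * norm (avg x) = inner (diag (avg x)) x"
    by (simp add: inner_diag power2_norm_eq_inner flip: power2_eq_square)
  also have "\<dots> \<le> norm (avg x) * norm x"
    using norm_cauchy_schwarz[of "diag (avg x)" x] by simp
  finally show ?thesis by (cases "avg x = 0") auto
qed

lemma bounded_linear_diag:
  "bounded_linear (diag :: 'a::real_inner \<Rightarrow> ('a, 'n::finite) hpow)"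
  by (rule bounded_linear_intro[where K = 1]) (simp_all add: hpow_eq_iff)

lemma bounded_linear_avg:
  "bounded_linear (avg :: ('a::real_inner, 'n::finite) hpow \<Rightarrow> 'a)"
  by (rule bounded_linear_intro[where K = 1])
    (simp_all add: avg_def[of "_ + _"] avg_def[of "_ *\<^sub>R _"] norm_avg_le,
     simp_all add: avg_def sum.distrib scaleR_add_right scaleR_sum_right)

text \<open>
  \<open>J\<close> is isometric and \<open>J*\<close> a contraction, which bounds \<open>\<parallel>J A J*\<parallel>\<close> by \<open>\<parallel>A\<parallel>\<close>. Equality is seen on the
  vectors \<open>J u\<close>, where \<open>J* J u = u\<close>.
\<close>

lemma onorm_diag_conjugate:
  fixes A :: "'a::real_inner \<Rightarrow> 'a"
  assumes A: "bounded_linear A"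
  shows "onorm (\<lambda>x :: ('a, 'n::finite) hpow. diag (A (avg x)) :: ('a, 'n) hpow) = onorm A"
proof (rule antisym)
  let ?B = "\<lambda>x :: ('a, 'n) hpow. diag (A (avg x)) :: ('a, 'n) hpow"
  have B: "bounded_linear ?B"
    by (intro bounded_linear_compose[OF bounded_linear_diag] bounded_linear_compose[OF A]
        bounded_linear_avg)
  show "onorm ?B \<le> onorm A"
  proof (rule onorm_bound[OF onorm_pos_le[OF A]])
    fix x :: "('a, 'n) hpow"
    have "norm (A (avg x)) \<le> onorm A * norm (avg x)" by (rule onorm[OF A])
    also have "\<dots> \<le> onorm A * norm x" by (intro mult_left_mono norm_avg_le onorm_pos_le[OF A])
    finally show "norm (?B x) \<le> onorm A * norm x" by simp
  qed
  show "onorm A \<le> onorm ?B"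
  proof (rule onorm_bound[OF onorm_pos_le[OF B]])
    fix u
    show "norm (A u) \<le> onorm ?B * norm u" using onorm[OF B, of "diag u"] by simp
  qed
qed

lemma diagonal_subspace_eq: "diagonal_subspace = range diag"
  by (auto simp: diagonal_subspace_def diag_def)

text \<open>
  The case \<open>M = UNIV\<close> is the projection onto the diagonal.
\<close>

lemma metric_proj_range_diag:
  assumes "complemented M"
  shows "metric_proj (diag ` M) x = (diag (metric_proj M (avg x)) :: ('a::real_inner, 'n::finite) hpow)"
proof (rule metric_proj_eqI)
  have "subspace (diag ` M :: ('a, 'n) hpow set)"
    using bounded_linear_diag complemented_imp_subspace[OF assms]
    by (intro linear_subspace_image bounded_linear.linear)
  then show "subspace (diag ` M :: ('a, 'n) hpow set)" .
  show "diag (metric_proj M (avg x)) \<in> diag ` M" using metric_proj_in[OF assms] by blast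
  show "x - diag (metric_proj M (avg x)) \<in> (diag ` M)\<^sup>\<bottom>"
    using inner_metric_proj_member[OF assms, of _ "avg x"]
    by (simp add: mem_orthogonal_comp_iff inner_diff_left inner_diag_right)
qed

lemma
  fixes L :: "'n::finite \<Rightarrow> 'a::real_inner set"
  assumes "\<And>i. complemented (L i)"
  shows complemented_product_subspace: "complemented (product_subspace L)"
    and metric_proj_product_subspace:
      "metric_proj (product_subspace L) x = tuple (\<lambda>i. metric_proj (L i) (coord x i))"
proof -
  let ?f = "\<lambda>x. tuple (\<lambda>i. metric_proj (L i) (coord x i))"
  have 1: "subspace (product_subspace L)"
    using complemented_imp_subspace[OF assms]
    by (auto simp: subspace_def product_subspace_def)
  have 2: "?f x \<in> product_subspace L" for x
    using metric_proj_in[OF assms] by (simp add: product_subspace_def)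
  have 3: "x - ?f x \<in> (product_subspace L)\<^sup>\<bottom>" for x
    using inner_metric_proj_member[OF assms]
    by (simp add: mem_orthogonal_comp_iff product_subspace_def inner_hpow_def inner_diff_left)
  show "complemented (product_subspace L)" "metric_proj (product_subspace L) x = ?f x"
    using complementedI[OF 1 2 3] by simp_all
qed

lemma avg_proj_diag:
  assumes "\<And>i. complemented (L i)"
  shows "avg (metric_proj (product_subspace L) (diag u)) = mean_proj L u"
  by (simp add: metric_proj_product_subspace[OF assms] avg_def mean_proj_def)

section \<open>The lifted projection and its norm\<close>

text \<open>
  The operator \<open>V\<close> with \<open>V* V = mean_proj L\<close>. On the product of the \<open>L\<^sub>i\<close> its adjoint \<open>V*\<close> is
  \<^const>\<open>avg\<close> (lemma \<open>inner_lifted_proj\<close>).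
\<close>

definition lifted_proj :: "('n::finite \<Rightarrow> 'a::real_inner set) \<Rightarrow> 'a \<Rightarrow> ('a, 'n) hpow"
  where "lifted_proj L u = metric_proj (product_subspace L) (diag u)"

context
  fixes L :: "'n::finite \<Rightarrow> 'a::real_inner set"
  assumes L: "\<And>i. complemented (L i)"
begin

lemma bounded_linear_lifted_proj: "bounded_linear (lifted_proj L)"
  unfolding lifted_proj_def
  by (intro bounded_linear_compose[OF bounded_linear_metric_proj] bounded_linear_diag
      complemented_product_subspace L)

lemma lifted_proj_in: "lifted_proj L u \<in> product_subspace L"
  unfolding lifted_proj_def by (intro metric_proj_in complemented_product_subspace L)

lemma inner_lifted_proj:
  "x \<in> product_subspace L \<Longrightarrow> inner (lifted_proj L u) x = inner u (avg x)"
  unfolding lifted_proj_def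
  by (simp add: inner_metric_proj_member complemented_product_subspace L inner_diag)

lemma inner_mean_proj: "inner (mean_proj L u) v = inner (lifted_proj L u) (lifted_proj L v)"
proof -
  have "inner (lifted_proj L u) (lifted_proj L v) = inner v (avg (lifted_proj L u))"
    by (metis inner_lifted_proj[OF lifted_proj_in] inner_commute)
  then show ?thesis
    by (simp add: lifted_proj_def avg_proj_diag[OF L] inner_commute)
qed

lemma bounded_linear_mean_proj: "bounded_linear (mean_proj L)"
  unfolding mean_proj_def
  by (intro bounded_linear_const_scaleR bounded_linear_sum bounded_linear_metric_proj L)

lemma onorm_mean_proj: "onorm (mean_proj L) = (onorm (lifted_proj L))\<^sup>2"
  by (rule onorm_adjoint_compose[OF bounded_linear_lifted_proj bounded_linear_mean_proj
        inner_mean_proj])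

text \<open>
  This lemma and the next one say that \<open>\<parallel>V\<parallel>\<close> is the least constant \<open>b \<ge> 0\<close> such that
  \<open>\<parallel>avg x\<parallel> \<le> b \<parallel>x\<parallel>\<close> on the product of the \<open>L\<^sub>i\<close>; this is the equality of the norms of \<open>V\<close>
  and \<open>V*\<close>, in the form that matches a supremum of quotients.
\<close>

lemma norm_avg_le_lifted:
  assumes x: "x \<in> product_subspace L"
  shows "norm (avg x) \<le> onorm (lifted_proj L) * norm x"
proof -
  have "norm (avg x) * norm (avg x) = inner (lifted_proj L (avg x)) x"
    by (simp add: inner_lifted_proj[OF x] power2_norm_eq_inner flip: power2_eq_square)
  also have "\<dots> \<le> norm (lifted_proj L (avg x)) * norm x" by (rule norm_cauchy_schwarz)
  also have "\<dots> \<le> (onorm (lifted_proj L) * norm (avg x)) * norm x"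
    by (intro mult_right_mono onorm[OF bounded_linear_lifted_proj]) simp
  finally have "norm (avg x) * norm (avg x) \<le> (onorm (lifted_proj L) * norm x) * norm (avg x)"
    by (simp add: mult_ac)
  then show ?thesis
    using onorm_pos_le[OF bounded_linear_lifted_proj] by (cases "avg x = 0") auto
qed

lemma onorm_lifted_proj_le:
  assumes "b \<ge> 0" and "\<And>x. x \<in> product_subspace L \<Longrightarrow> norm (avg x) \<le> b * norm x"
  shows "onorm (lifted_proj L) \<le> b"
proof (rule onorm_bound[OF assms(1)])
  fix u
  let ?v = "lifted_proj L u"
  have "norm ?v * norm ?v = inner u (avg ?v)"
    by (simp add: inner_lifted_proj[OF lifted_proj_in, symmetric] power2_norm_eq_inner
        flip: power2_eq_square)
  also have "\<dots> \<le> norm u * norm (avg ?v)" by (rule norm_cauchy_schwarz)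
  also have "\<dots> \<le> norm u * (b * norm ?v)" by (intro mult_left_mono assms(2) lifted_proj_in) simp
  finally have "norm ?v * norm ?v \<le> (b * norm u) * norm ?v" by (simp add: mult_ac)
  then show "norm ?v \<le> b * norm u" using assms(1) by (cases "?v = 0") auto
qed

end

section \<open>Removing the intersection, and the Friedrichs angle with the diagonal\<close>

lemma complemented_UNIV: "complemented UNIV"
  by (auto simp: complemented_def intro: bexI[of _ x for x] subspace_0)

lemma metric_proj_UNIV: "metric_proj UNIV x = x"
  by (simp add: metric_proj_member complemented_UNIV)

lemma product_Int_diagonal:
  "product_subspace Ms \<inter> diagonal_subspace = diag ` (\<Inter>i. Ms i)"
  by (auto simp: diagonal_subspace_eq product_subspace_def diag_def)

context
  fixes Ms :: "'n::finite \<Rightarrow> 'a::real_inner set"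
  assumes Ms: "\<And>i. complemented (Ms i)" and M: "complemented (\<Inter>i. Ms i)"
begin

abbreviation reduced :: "'n \<Rightarrow> 'a set"
  where "reduced \<equiv> \<lambda>i. Ms i \<inter> (\<Inter>i. Ms i)\<^sup>\<bottom>"

lemma complemented_reduced: "complemented (reduced i)"
  by (intro complemented_relative Ms M) auto

lemma metric_proj_reduced:
  "metric_proj (reduced i) u = metric_proj (Ms i) u - metric_proj (\<Inter>i. Ms i) u"
  by (intro metric_proj_relative Ms M) auto

lemma mean_proj_reduced: "mean_proj reduced u = mean_proj Ms u - metric_proj (\<Inter>i. Ms i) u"
  by (simp add: mean_proj_def metric_proj_reduced sum_subtractf scaleR_diff_right
      sum_constant_scaleR)

lemma mean_proj_member:
  assumes "u \<in> (\<Inter>i. Ms i)"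
  shows "mean_proj Ms u = u"
proof -
  have "metric_proj (Ms i) u = u" for i using assms by (intro metric_proj_member Ms) auto
  then show ?thesis by (simp add: mean_proj_def sum_constant_scaleR)
qed

lemma metric_proj_mean_proj:
  "metric_proj (\<Inter>i. Ms i) (mean_proj Ms u) = metric_proj (\<Inter>i. Ms i) u"
proof -
  have "metric_proj (\<Inter>i. Ms i) (metric_proj (Ms i) u) = metric_proj (\<Inter>i. Ms i) u" for i
    by (intro metric_proj_subset Ms M) auto
  moreover note lin = bounded_linear.linear[OF bounded_linear_metric_proj[OF M]]
  ultimately show ?thesis
    by (simp add: mean_proj_def linear_scale[OF lin] linear_sum[OF lin] sum_constant_scaleR)
qed

text \<open>
  The reduced lift kills \<open>M\<close> and agrees with the original lift on \<open>M\<^sup>\<bottom>\<close>, so its norm can be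
  computed on \<open>M\<^sup>\<bottom>\<close> and with either family of subspaces.
\<close>

lemma lifted_proj_reduced:
  assumes "u \<in> (\<Inter>i. Ms i)\<^sup>\<bottom>"
  shows "lifted_proj reduced u = lifted_proj Ms u"
  unfolding lifted_proj_def metric_proj_product_subspace[OF complemented_reduced]
    metric_proj_product_subspace[OF Ms]
  using assms by (simp add: metric_proj_reduced metric_proj_orthogonal_comp[OF M])

lemma lifted_proj_reduced_member:
  assumes "u \<in> (\<Inter>i. Ms i)"
  shows "lifted_proj reduced u = 0"
proof -
  have "metric_proj (Ms i) u = u" for i using assms by (intro metric_proj_member Ms) auto
  then show ?thesis
    unfolding lifted_proj_def metric_proj_product_subspace[OF complemented_reduced]
    using assms by (simp add: metric_proj_reduced metric_proj_member[OF M] hpow_eq_iff)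
qed

text \<open>
  An admissible pair is \<open>(a, J u)\<close> with \<open>a \<in> C\<close>, \<open>u \<in> M\<^sup>\<bottom>\<close>, and \<open>\<langle>a, J u\<rangle> = \<langle>a, V u\<rangle> \<le> \<parallel>V\<parallel>\<close>. Conversely
  \<open>a = V u / \<parallel>V u\<parallel>\<close> is admissible, because every coordinate of \<open>V u\<close> lies in \<open>M\<^sup>\<bottom>\<close>, and it gives
  \<open>\<parallel>V u\<parallel>\<close>.
\<close>

lemma cos_product_diagonal:
  "cos_friedrichs (product_subspace Ms) diagonal_subspace = onorm (lifted_proj reduced)"
proof -
  let ?V = "lifted_proj reduced" and ?C = "product_subspace Ms"
  let ?D = "diagonal_subspace :: ('a, 'n) hpow set"
  let ?M = "\<Inter>i. Ms i"
  let ?X = "{\<bar>inner a b\<bar> | a b. a \<in> ?C \<inter> (?C \<inter> ?D)\<^sup>\<bottom> \<and> b \<in> ?D \<inter> (?C \<inter> ?D)\<^sup>\<bottom>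
      \<and> norm a \<le> 1 \<and> norm b \<le> 1}"
  have V: "bounded_linear ?V" by (rule bounded_linear_lifted_proj[OF complemented_reduced])
  have diag_perp: "diag u \<in> (?C \<inter> ?D)\<^sup>\<bottom> \<longleftrightarrow> u \<in> ?M\<^sup>\<bottom>" for u
    by (simp add: product_Int_diagonal mem_orthogonal_comp_iff inner_diag)
  have zero: "0 \<in> ?X"
    by (rule CollectI, rule exI[of _ 0], rule exI[of _ 0])
      (use complemented_imp_subspace[OF Ms] in
        \<open>auto simp: mem_orthogonal_comp_iff product_subspace_def subspace_0 diagonal_subspace_eq
          hpow_eq_iff intro!: image_eqI[of _ _ 0]\<close>)
  have "Sup ?X = onorm ?V"
  proof (rule cSup_eq_non_empty)
    show "?X \<noteq> {}" using zero by blast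
  next
    fix q assume "q \<in> ?X"
    then obtain a b where ab: "q = \<bar>inner a b\<bar>" "b \<in> ?D" "b \<in> (?C \<inter> ?D)\<^sup>\<bottom>" "norm b \<le> 1"
      and a: "a \<in> ?C" "norm a \<le> 1"
      by blast
    from ab(2) obtain u where b: "b = diag u" by (auto simp: diagonal_subspace_eq)
    have q: "q = \<bar>inner a (diag u)\<bar>" and u: "u \<in> ?M\<^sup>\<bottom>" "norm u \<le> 1"
      using ab unfolding b diag_perp by simp_all
    have "q = \<bar>inner (?V u) a\<bar>"
      using inner_lifted_proj[where L = Ms and u = u, OF Ms a(1)] q
      by (simp add: lifted_proj_reduced[OF u(1)] inner_diag_right inner_commute)
    also have "\<dots> \<le> norm (?V u) * norm a" by (rule Cauchy_Schwarz_ineq2)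
    also have "\<dots> \<le> (onorm ?V * 1) * 1"
    proof (intro mult_mono)
      show "norm (?V u) \<le> onorm ?V * 1"
        using onorm[OF V, of u] mult_left_mono[OF u(2) onorm_pos_le[OF V]] by linarith
    qed (use a(2) onorm_pos_le[OF V] in auto)
    finally show "q \<le> onorm ?V" by simp
  next
    fix y assume y: "\<And>q. q \<in> ?X \<Longrightarrow> q \<le> y"
    show "onorm ?V \<le> y"
    proof (rule onorm_bound)
      show y0: "0 \<le> y" using y zero by blast
      fix x
      \<comment> \<open>Only vectors of \<open>M\<^sup>\<bottom>\<close> give admissible pairs, so the component of \<open>x\<close> in \<open>M\<close> is removed.\<close>
      define u where "u = x - metric_proj ?M x"
      have u: "u \<in> ?M\<^sup>\<bottom>" unfolding u_def by (rule metric_proj_orthogonal[OF M])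
      have "u = metric_proj (UNIV \<inter> ?M\<^sup>\<bottom>) x"
        unfolding u_def using metric_proj_relative[OF complemented_UNIV M] by (simp add: metric_proj_UNIV)
      then have norm_u: "norm u \<le> norm x"
        using norm_metric_proj_le[OF complemented_relative[OF complemented_UNIV M]] by simp
      have Vu: "?V x = ?V u"
        unfolding u_def using lifted_proj_reduced_member[OF metric_proj_in[OF M]]
        by (simp add: linear_simps(2)[OF V])
      have "norm (?V u) \<le> y * norm u"
      proof (cases "?V u = 0")
        case True
        then show ?thesis using y0 by simp
      next
        case False
        then have u0: "u \<noteq> 0" using linear_simps(3)[OF V] by metis
        define a where "a = (1 / norm (?V u)) *\<^sub>R ?V u"
        have Vin: "?V u \<in> product_subspace reduced"
          by (rule lifted_proj_in[OF complemented_reduced])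
        have perp: "inner (coord (?V u) i) m = 0" if "m \<in> ?M" for i m
          using Vin that by (auto simp: product_subspace_def mem_orthogonal_comp_iff)
        have "a \<in> ?C"
          using Vin complemented_imp_subspace[OF Ms]
          by (auto simp: a_def product_subspace_def intro!: subspace_scale)
        moreover have "a \<in> (?C \<inter> ?D)\<^sup>\<bottom>"
          unfolding product_Int_diagonal mem_orthogonal_comp_iff
          by (auto simp: a_def inner_hpow_def perp)
        moreover have "diag ((1 / norm u) *\<^sub>R u) \<in> (?C \<inter> ?D)\<^sup>\<bottom>"
          using u unfolding diag_perp by (simp add: mem_orthogonal_comp_iff)
        ultimately have "\<bar>inner a (diag ((1 / norm u) *\<^sub>R u))\<bar> \<in> ?X"
          using u0 False by (intro CollectI exI conjI refl)
            (auto simp: a_def diagonal_subspace_eq)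
        from y[OF this] have "\<bar>inner u (avg (?V u))\<bar> / (norm (?V u) * norm u) \<le> y"
          using False u0
          by (simp add: a_def inner_diag_right abs_mult inner_commute[of u] mult.commute
              linear_simps(5)[OF bounded_linear_avg])
        moreover have "inner u (avg (?V u)) = norm (?V u) * norm (?V u)"
          using inner_lifted_proj[where L = reduced and u = u, OF complemented_reduced Vin]
          by (simp add: power2_norm_eq_inner flip: power2_eq_square)
        ultimately show ?thesis using False u0 by (simp add: field_simps)
      qed
      also have "\<dots> \<le> y * norm x" by (rule mult_left_mono[OF norm_u y0])
      finally show "norm (?V x) \<le> y * norm x" using Vu by simp
    qed
  qed
  then show ?thesis unfolding cos_friedrichs_def .
qed

end

section \<open>The Friedrichs number\<close>

lemma sum_inner_off_diagonal:
  fixes x :: "'n::finite \<Rightarrow> 'a::real_inner"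
  shows "(\<Sum>(i, j)\<in>{(i, j). i \<noteq> j}. inner (x i) (x j))
    = (norm (\<Sum>i\<in>UNIV. x i))\<^sup>2 - (\<Sum>i\<in>UNIV. (norm (x i))\<^sup>2)"
proof -
  let ?f = "\<lambda>(i, j). inner (x i) (x j)"
  have "(norm (\<Sum>i\<in>UNIV. x i))\<^sup>2 = sum ?f UNIV"
    by (simp add: power2_norm_eq_inner inner_sum_left inner_sum_right sum.cartesian_product inner_commute)
  also have "(UNIV :: ('n \<times> 'n) set) = {(i, j). i \<noteq> j} \<union> (\<lambda>i. (i, i)) ` UNIV"
    by auto
  also have "sum ?f \<dots> = sum ?f {(i, j). i \<noteq> j} + sum ?f ((\<lambda>i. (i, i)) ` UNIV)"
    by (rule sum.union_disjoint) auto
  also have "sum ?f ((\<lambda>i. (i, i)) ` UNIV) = (\<Sum>i\<in>UNIV. (norm (x i))\<^sup>2)"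
    by (subst sum.reindex) (auto simp: inj_on_def power2_norm_eq_inner)
  finally show ?thesis by simp
qed

text \<open>
  Solving \<open>(r - 1) / r * q + 1 / r = (\<parallel>avg x\<parallel> / \<parallel>x\<parallel>)\<^sup>2\<close> for \<open>q\<close> gives the right-hand side.
\<close>

lemma friedrichs_quotient_eq:
  fixes x :: "('a::real_inner, 'n::finite) hpow"
  assumes r: "CARD('n) \<ge> 2" and "x \<noteq> 0"
  shows "1 / (real CARD('n) - 1) * ((\<Sum>(i, j)\<in>{(i, j). i \<noteq> j}. inner (coord x i) (coord x j))
      / (\<Sum>i\<in>UNIV. (norm (coord x i))\<^sup>2))
    = (real CARD('n) * (norm (avg x) / norm x)\<^sup>2 - 1) / (real CARD('n) - 1)"
proof -
  let ?r = "real CARD('n)"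
  have "(\<Sum>i\<in>UNIV. (norm (coord x i))\<^sup>2) = ?r * (norm x)\<^sup>2"
    by (simp add: norm_hpow_square)
  moreover have "(\<Sum>i\<in>UNIV. coord x i) = ?r *\<^sub>R avg x"
    by (simp add: avg_def)
  ultimately show ?thesis
    using r \<open>x \<noteq> 0\<close>
    by (simp add: sum_inner_off_diagonal power_mult_distrib power_divide field_simps power2_eq_square)
qed

lemma friedrichs_quotients_eq:
  fixes Ms :: "'n::finite \<Rightarrow> 'a::real_inner set"
  assumes r: "CARD('n) \<ge> 2"
  shows "friedrichs_quotients Ms =
    (\<lambda>x. (real CARD('n) * (norm (avg x) / norm x)\<^sup>2 - 1) / (real CARD('n) - 1)) `
      (product_subspace (\<lambda>i. Ms i \<inter> (\<Inter>i. Ms i)\<^sup>\<bottom>) - {0})" (is "_ = ?q ` (?N - {0})")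
proof -
  have nz: "(\<Sum>i\<in>UNIV. (norm (coord x i))\<^sup>2) \<noteq> 0 \<longleftrightarrow> x \<noteq> 0" for x :: "('a, 'n) hpow"
    using norm_hpow_square[of x] by (auto simp: hpow_eq_iff sum_nonneg_eq_0_iff)
  show ?thesis
  proof (intro equalityI subsetI)
    fix q assume "q \<in> friedrichs_quotients Ms"
    then obtain f where f: "\<forall>i. f i \<in> Ms i \<inter> (\<Inter>i. Ms i)\<^sup>\<bottom>" "(\<Sum>i\<in>UNIV. (norm (f i))\<^sup>2) \<noteq> 0"
      and q: "q = 1 / (real CARD('n) - 1) *
       ((\<Sum>(i, j)\<in>{(i, j). i \<noteq> j}. inner (f i) (f j)) / (\<Sum>i\<in>UNIV. (norm (f i))\<^sup>2))"
      unfolding friedrichs_quotients_def by blast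
    have "tuple f \<in> ?N - {0}" using f nz[of "tuple f"] by (simp add: product_subspace_def)
    moreover have "q = ?q (tuple f)"
      using friedrichs_quotient_eq[OF r, of "tuple f"] f(2) nz[of "tuple f"] q by simp
    ultimately show "q \<in> ?q ` (?N - {0})" by blast
  next
    fix q assume "q \<in> ?q ` (?N - {0})"
    then obtain x where x: "x \<in> ?N" "x \<noteq> 0" and q: "q = ?q x" by blast
    show "q \<in> friedrichs_quotients Ms"
      unfolding friedrichs_quotients_def q friedrichs_quotient_eq[OF r x(2), symmetric]
      using x(1) nz[of x] x(2) by (auto simp: product_subspace_def intro!: exI[of _ "coord x"])
  qed
qed

text \<open>
  By the preceding description the quotients are increasing affine images of
  \<open>(\<parallel>avg x\<parallel> / \<parallel>x\<parallel>)\<^sup>2\<close>, whose supremum is \<open>\<parallel>V\<parallel>\<^sup>2\<close>. If there are no quotients, all the reduced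
  subspaces are zero and \<open>V = 0\<close>; the default value \<open>- 1 / (r - 1)\<close> is the one that the affine
  map sends to \<open>0\<close>.
\<close>

lemma friedrichs_number_eq:
  fixes Ms :: "'n::finite \<Rightarrow> 'a::real_inner set"
  assumes r: "CARD('n) \<ge> 2"
    and Ms: "\<And>i. complemented (Ms i)" and M: "complemented (\<Inter>i. Ms i)"
  shows "(real CARD('n) - 1) / real CARD('n) * friedrichs_number Ms + 1 / real CARD('n)
    = (onorm (lifted_proj (\<lambda>i. Ms i \<inter> (\<Inter>i. Ms i)\<^sup>\<bottom>)))\<^sup>2"
proof -
  let ?r = "real CARD('n)"
  let ?N = "\<lambda>i. Ms i \<inter> (\<Inter>i. Ms i)\<^sup>\<bottom>"
  let ?V = "lifted_proj ?N"
  let ?q = "\<lambda>x. (?r * (norm (avg x) / norm x)\<^sup>2 - 1) / (?r - 1)"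
  note Nc = complemented_reduced[OF Ms M]
  have s0: "onorm ?V \<ge> 0" by (rule onorm_pos_le[OF bounded_linear_lifted_proj[OF Nc]])
  have "friedrichs_number Ms = (?r * (onorm ?V)\<^sup>2 - 1) / (?r - 1)"
  proof (cases "friedrichs_quotients Ms = {}")
    case True
    then have N0: "product_subspace ?N \<subseteq> {0}"
      unfolding friedrichs_quotients_eq[OF r] by blast
    have "onorm ?V \<le> 0"
      by (rule onorm_lifted_proj_le[OF Nc]) (use N0 in \<open>auto simp: avg_def\<close>)
    with s0 have "onorm ?V = 0" by (rule order_antisym[rotated])
    then show ?thesis using True by (simp add: friedrichs_number_def)
  next
    case False
    have "Sup (friedrichs_quotients Ms) = (?r * (onorm ?V)\<^sup>2 - 1) / (?r - 1)"
    proof (rule cSup_eq_non_empty[OF False])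
      fix z assume "z \<in> friedrichs_quotients Ms"
      then obtain x where x: "x \<in> product_subspace ?N" "x \<noteq> 0" and z: "z = ?q x"
        unfolding friedrichs_quotients_eq[OF r] by blast
      have "norm (avg x) / norm x \<le> onorm ?V"
        using norm_avg_le_lifted[OF Nc x(1)] x(2) by (simp add: field_simps)
      then have "(norm (avg x) / norm x)\<^sup>2 \<le> (onorm ?V)\<^sup>2" by (intro power_mono) auto
      then show "z \<le> (?r * (onorm ?V)\<^sup>2 - 1) / (?r - 1)"
        unfolding z using r by (intro divide_right_mono diff_right_mono mult_left_mono) auto
    next
      fix y assume y: "\<And>z. z \<in> friedrichs_quotients Ms \<Longrightarrow> z \<le> y"
      \<comment> \<open>The image of the bound \<open>y\<close> under \<open>q \<mapsto> (r - 1) / r * q + 1 / r\<close>.\<close>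
      define b where "b = ((?r - 1) * y + 1) / ?r"
      have b: "(norm (avg x) / norm x)\<^sup>2 \<le> b" if "x \<in> product_subspace ?N" "x \<noteq> 0" for x
      proof -
        have "?q x \<le> y" by (rule y) (use that in \<open>auto simp: friedrichs_quotients_eq[OF r]\<close>)
        then show ?thesis using r by (simp add: b_def field_simps)
      qed
      have b0: "b \<ge> 0"
        using False b order_trans[OF zero_le_power2] unfolding friedrichs_quotients_eq[OF r] by blast
      have "onorm ?V \<le> sqrt b"
      proof (rule onorm_lifted_proj_le[OF Nc])
        fix x assume x: "x \<in> product_subspace ?N"
        show "norm (avg x) \<le> sqrt b * norm x"
        proof (cases "x = 0")
          case False
          have "norm (avg x) / norm x \<le> sqrt b" by (rule real_le_rsqrt[OF b[OF x False]])
          then show ?thesis using False by (simp add: field_simps)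
        qed (simp add: avg_def)
      qed (use b0 in simp)
      then have "(onorm ?V)\<^sup>2 \<le> b" using s0 b0 by (metis real_sqrt_le_iff real_sqrt_unique sqrt_le_D)
      then show "(?r * (onorm ?V)\<^sup>2 - 1) / (?r - 1) \<le> y"
        using r by (simp add: b_def field_simps)
    qed
    then show ?thesis using False by (simp add: friedrichs_number_def)
  qed
  then show ?thesis using r by (simp add: field_simps)
qed

section \<open>The chain of equalities\<close>

theorem theorem8:
  fixes Ms :: "'n::finite \<Rightarrow> 'a::{real_inner, complete_space} set"
    and M :: "'a set"
    and C D :: "('a, 'n) hpow set"
    and r k :: nat
  assumes r: "r = CARD('n)" "r \<ge> 2"
    and Ms: "\<And>i. subspace (Ms i)" "\<And>i. closed (Ms i)"
    and M: "M = (\<Inter>i. Ms i)"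
    and C: "C = product_subspace Ms"
    and D: "D = diagonal_subspace"
    and k: "k \<ge> 1"
  shows
    "onorm (\<lambda>x. (mean_proj Ms ^^ k) x - metric_proj M x)
       = onorm (\<lambda>x. mean_proj Ms x - metric_proj M x) ^ k
     \<and> onorm (\<lambda>x. mean_proj Ms x - metric_proj M x) ^ k
       = ((real r - 1) / real r * friedrichs_number Ms + 1 / real r) ^ k
     \<and> ((real r - 1) / real r * friedrichs_number Ms + 1 / real r) ^ k
       = cos_friedrichs C D ^ (2 * k)
     \<and> cos_friedrichs C D ^ (2 * k)
       = onorm (\<lambda>x. (metric_proj D \<circ> metric_proj C \<circ> metric_proj D) x - metric_proj (C \<inter> D) x) ^ k
     \<and> onorm (\<lambda>x. (metric_proj D \<circ> metric_proj C \<circ> metric_proj D) x - metric_proj (C \<inter> D) x) ^ k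
       = onorm (\<lambda>x. ((metric_proj D \<circ> metric_proj C \<circ> metric_proj D) ^^ k) x - metric_proj (C \<inter> D) x)"
proof -
  have Msc: "complemented (Ms i)" for i by (intro closed_subspace_complemented Ms)
  have Mc: "complemented M"
    unfolding M by (intro closed_subspace_complemented closed_INT subspace_Inter ballI)
      (use Ms in auto)
  define N where "N i = Ms i \<inter> M\<^sup>\<bottom>" for i
  define s where "s = onorm (lifted_proj N)"
  have Nc: "complemented (N i)" for i
    unfolding N_def M by (intro complemented_relative Msc Mc[unfolded M]) auto
  have T_minus: "mean_proj Ms x - metric_proj M x = mean_proj N x" for x
    unfolding N_def M by (rule mean_proj_reduced[symmetric, OF Msc Mc[unfolded M]])
  have norm_N: "onorm (mean_proj N) = s\<^sup>2"
    unfolding s_def by (rule onorm_mean_proj[OF Nc])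
  have T: "linear (mean_proj Ms)" and P: "linear (metric_proj M)"
    by (intro bounded_linear.linear bounded_linear_mean_proj bounded_linear_metric_proj Msc Mc)+
  have power: "(mean_proj Ms ^^ k) x - metric_proj M x = (mean_proj N ^^ k) x" for x
    unfolding T_minus[symmetric]
  proof (rule funpow_minus_projection[OF T P _ _ _ k])
    fix x
    show "mean_proj Ms (metric_proj M x) = metric_proj M x"
      by (rule mean_proj_member[OF Msc Mc[unfolded M]], fold M, rule metric_proj_in[OF Mc])
    show "metric_proj M (mean_proj Ms x) = metric_proj M x"
      unfolding M by (intro metric_proj_mean_proj Msc Mc[unfolded M])
    show "metric_proj M (metric_proj M x) = metric_proj M x"
      by (rule metric_proj_subset[OF Mc Mc order_refl])
  qed
  have "inner (mean_proj N x) y = inner x (mean_proj N y)" for x y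
    using inner_mean_proj[where L = N and u = x and v = y, OF Nc]
      inner_mean_proj[where L = N and u = y and v = x, OF Nc]
    by (simp add: inner_commute)
  then have onorm_power: "onorm (mean_proj N ^^ k) = onorm (mean_proj N) ^ k"
    by (intro onorm_funpow_selfadjoint bounded_linear_mean_proj Nc k)

  have PD: "metric_proj D x = diag (avg x)" for x :: "('a, 'n) hpow"
    unfolding D diagonal_subspace_eq
    by (subst metric_proj_range_diag) (simp_all add: complemented_UNIV metric_proj_UNIV)
  have PCD: "metric_proj (C \<inter> D) x = diag (metric_proj M (avg x))" for x :: "('a, 'n) hpow"
    unfolding C D product_Int_diagonal M by (rule metric_proj_range_diag[OF Mc[unfolded M]])
  let ?Q = "metric_proj D \<circ> metric_proj C \<circ> metric_proj D"
  have Q: "?Q x = diag (mean_proj Ms (avg x))" for x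
    by (simp add: PD C avg_proj_diag[OF Msc])
  have Qk: "(?Q ^^ k) x = diag ((mean_proj Ms ^^ k) (avg x))" for x
    using k by (induction k rule: dec_induct) (simp_all add: PD C avg_proj_diag[OF Msc])
  have diff: "diag u - diag v = (diag (u - v) :: ('a, 'n) hpow)" for u v :: 'a
    by (simp add: hpow_eq_iff)
  have E: "onorm (\<lambda>x. ?Q x - metric_proj (C \<inter> D) x) = onorm (mean_proj N)"
    unfolding Q PCD diff T_minus by (rule onorm_diag_conjugate[OF bounded_linear_mean_proj[OF Nc]])
  have lin_k: "bounded_linear (mean_proj N ^^ k)"
    by (rule bounded_linear_funpow[OF bounded_linear_mean_proj[OF Nc]])
  have Ek: "onorm (\<lambda>x. (?Q ^^ k) x - metric_proj (C \<inter> D) x) = onorm (mean_proj N ^^ k)"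
    unfolding Qk PCD diff power by (rule onorm_diag_conjugate[OF lin_k])
  have F: "(real r - 1) / real r * friedrichs_number Ms + 1 / real r = s\<^sup>2"
    unfolding s_def N_def M r(1)
    by (rule friedrichs_number_eq) (use r Msc Mc M in auto)
  have c: "cos_friedrichs C D = s"
    unfolding s_def N_def M C D by (rule cos_product_diagonal) (use Msc Mc M in auto)
  show ?thesis
    unfolding E Ek F c T_minus power onorm_power norm_N by (simp add: power_mult)
qed

end
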